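(* Let $\ell > m > 0$ be integers with $\gcd(\ell,m)=1$, let $n \geq 1$ be an integer, and let $$Y_n(t) := t^n + \sum_{k=1}^{n} (-1)^k \binom{n}{k} t^{n-k}\, \ell\, Q_k(m, m-\ell).$$ If there is a prime $p$ such that $p \mid \ell$, $p^2 \nmid \ell$, and $p \nmid n$, then $Y_n$ is irreducible over $\mathbb{Z}$.
   Context: For integers $a \neq b$ and $k \ge 1$, $Q_k(a,b) := \frac{a^k - b^k}{a-b} = \sum_{i=0}^{k-1} a^{k-1-i} b^i$. A polynomial $f \in \mathbb{Z}[t]$ is called reducible (over $\mathbb{Z}$) if $f = gh$ with $g,h \in \mathbb{Z}[t]$ both of positive degree; otherwise it is called irreducible (over $\mathbb{Z}$). *)

theory Defs
  imports "HOL-Computational_Algebra.Computational_Algebra"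
begin

text \<open>For \<open>a \<noteq> b\<close> the integer division below is exact (see \<open>Q_mult_diff\<close>); the value
  at \<open>a = b\<close> is irrelevant.\<close>

definition Q :: "nat \<Rightarrow> int \<Rightarrow> int \<Rightarrow> int" where
  "Q k a b = (a ^ k - b ^ k) div (a - b)"

lemma Q_eq_sum:
  assumes "a \<noteq> b"
  shows "Q k a b = (\<Sum>i<k. a ^ (k - 1 - i) * b ^ i)"
proof -
  have "a ^ k - b ^ k = (a - b) * (\<Sum>i<k. b ^ (k - Suc i) * a ^ i)"
    by (rule power_diff_sumr2)
  also have "(\<Sum>i<k. b ^ (k - Suc i) * a ^ i) = (\<Sum>i<k. a ^ (k - 1 - i) * b ^ i)"
    by (subst sum.nat_diff_reindex [symmetric]) (auto intro!: sum.cong simp: mult.commute)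
  finally show ?thesis
    using assms by (simp add: Q_def)
qed

lemma Q_mult_diff: "(a - b) * Q k a b = a ^ k - b ^ k"
proof (cases "a = b")
  case False
  have "(a - b) dvd (a ^ k - b ^ k)"
    by (simp add: power_diff_sumr2)
  then show ?thesis
    by (simp add: Q_def)
qed simp

definition Y :: "int \<Rightarrow> int \<Rightarrow> nat \<Rightarrow> int poly" where
  "Y l m n = monom 1 n +
     (\<Sum>k = 1..n. monom ((-1) ^ k * int (n choose k) * l * Q k m (m - l)) (n - k))"

text \<open>Unlike the library predicate \<^const>\<open>irreducible\<close> on \<^typ>\<open>int poly\<close>, this notion ignores
  factorizations with a constant factor.\<close>

definition reducible_over_int :: "int poly \<Rightarrow> bool" where
  "reducible_over_int f \<longleftrightarrow> (\<exists>g h. f = g * h \<and> degree g > 0 \<and> degree h > 0)"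

definition irreducible_over_int :: "int poly \<Rightarrow> bool" where
  "irreducible_over_int f \<longleftrightarrow> \<not> reducible_over_int f"

end

theory Submission
  imports Defs
begin

text \<open>Eisenstein's criterion at \<open>p\<close>: every non-leading coefficient of \<open>Y\<close> has the factor \<open>l\<close>. As
  \<open>m - l \<equiv> m\<close> modulo \<open>p\<close>, all \<open>n\<close> terms of the sum \<open>Q\<^sub>n(m, m - l)\<close> are congruent to \<open>m ^ (n - 1)\<close>, so
  it is congruent to \<open>n * m ^ (n - 1)\<close>, which is prime to \<open>p\<close>. Hence \<open>p\<close> divides the constant term
  \<open>\<plusminus> l Q\<^sub>n(m, m - l)\<close> exactly once.\<close>

text \<open>Induction on \<open>i\<close>: apart from \<open>coeff g i * coeff h 0\<close>, each
  term of the \<open>i\<close>-th coefficient of \<open>g * h\<close> contains a lower coefficient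
  of \<open>g\<close>.\<close>

lemma prime_elem_dvd_coeff_mult_left:
  fixes p :: "'a :: idom"
  assumes p: "prime_elem p" and h0: "\<not> p dvd coeff h 0"
    and low: "\<And>j. j \<le> d \<Longrightarrow> p dvd coeff (g * h) j"
    and "i \<le> d"
  shows "p dvd coeff g i"
  using \<open>i \<le> d\<close>
proof (induction i rule: less_induct)
  case (less i)
  have "coeff (g * h) i = coeff g i * coeff h 0 + (\<Sum>j<i. coeff g j * coeff h (i - j))"
    by (simp add: coeff_mult flip: lessThan_Suc_atMost)
  moreover have "p dvd (\<Sum>j<i. coeff g j * coeff h (i - j))"
    using less by (intro dvd_sum) auto
  ultimately have "p dvd coeff g i * coeff h 0"
    using low[OF less.prems] by (simp add: dvd_add_left_iff)
  with p h0 show ?case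
    by (simp add: prime_elem_dvd_mult_iff)
qed

lemma eisenstein_criterion:
  fixes p :: "'a :: idom"
  assumes p: "prime_elem p"
    and lead: "\<not> p dvd lead_coeff f"
    and low: "\<And>i. i < degree f \<Longrightarrow> p dvd coeff f i"
    and const: "\<not> p ^ 2 dvd coeff f 0"
    and f: "f = g * h"
  shows "degree g = 0 \<or> degree h = 0"
proof -
  have aux: "degree b = 0"
    if ab: "f = a * b" and b0: "\<not> p dvd coeff b 0" for a b
  proof (rule ccontr)
    assume "degree b \<noteq> 0"
    have "a \<noteq> 0" "b \<noteq> 0"
      using lead ab by auto
    \<comment> \<open>This keeps the index \<open>degree a\<close> in the range of
      \<open>low\<close>, so the divisibility reaches the leading coefficient of
      \<open>a\<close>.\<close>
    with \<open>degree b \<noteq> 0\<close> have "degree a < degree f"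
      by (simp add: ab degree_mult_eq)
    then have "\<And>j. j \<le> degree a \<Longrightarrow> p dvd coeff (a * b) j"
      unfolding ab [symmetric] by (intro low) simp
    then have "p dvd lead_coeff a"
      by (rule prime_elem_dvd_coeff_mult_left[OF p b0]) auto
    with lead show False
      by (simp add: ab lead_coeff_mult)
  qed
  \<comment> \<open>Otherwise \<open>p * p\<close> would divide the product of the constant
    terms.\<close>
  have "\<not> p dvd coeff h 0 \<or> \<not> p dvd coeff g 0"
    using const mult_dvd_mono[of p "coeff g 0" p "coeff h 0"]
    by (auto simp: f coeff_mult_0 power2_eq_square)
  then show ?thesis
    using aux[of g h] aux[of h g] f by (auto simp: mult.commute)
qed

lemma coeff_Y:
  "coeff (Y l m n) i =
     (if i = n then 1 else if i < n then
        (-1) ^ (n - i) * int (n choose (n - i)) * l * Q (n - i) m (m - l) else 0)"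
proof -
  let ?c = "\<lambda>k. (-1) ^ k * int (n choose k) * l * Q k m (m - l)"
  have "coeff (Y l m n) i = (if i = n then 1 else 0) + (\<Sum>k = 1..n. if n - k = i then ?c k else 0)"
    by (simp add: Y_def coeff_sum)
  \<comment> \<open>Truncated subtraction does no harm: if \<open>i \<ge> n\<close>, both conditions
    fail for every \<open>k \<ge> 1\<close> in the range.\<close>
  also have "(\<Sum>k = 1..n. if n - k = i then ?c k else 0) = (\<Sum>k = 1..n. if k = n - i then ?c k else 0)"
    by (rule sum.cong) auto
  also have "\<dots> = (if i < n then ?c (n - i) else 0)"
    by (subst sum.delta) auto
  finally show ?thesis
    by simp
qed

lemma degree_Y: "degree (Y l m n) = n"
  by (intro antisym degree_le le_degree) (auto simp: coeff_Y)

lemma Q_cong: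
  assumes "a \<noteq> b" and "p dvd a - b"
  shows "p dvd Q n a b - int n * a ^ (n - 1)"
proof -
  have "Q n a b - int n * a ^ (n - 1) = (\<Sum>i<n. a ^ (n - 1 - i) * b ^ i - a ^ (n - 1))"
    using assms by (simp add: Q_eq_sum sum_subtractf)
  also have "\<dots> = (\<Sum>i<n. a ^ (n - 1 - i) * (b ^ i - a ^ i))"
    by (intro sum.cong) (auto simp: right_diff_distrib simp flip: power_add)
  also have "p dvd \<dots>"
  proof (intro dvd_sum dvd_mult)
    fix i
    have "b - a dvd b ^ i - a ^ i"
      by (simp add: power_diff_sumr2)
    with assms(2) show "p dvd b ^ i - a ^ i"
      by (metis dvd_trans dvd_diff_commute)
  qed
  finally show ?thesis .
qed

theorem theorem11:
  fixes l m :: int and n :: nat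
  assumes "l > m" and "m > 0" and "gcd l m = 1" and "n \<ge> 1"
    and "\<exists>p::int. prime p \<and> p dvd l \<and> \<not> p ^ 2 dvd l \<and> \<not> p dvd int n"
  shows "irreducible_over_int (Y l m n)"
proof -
  from assms(5) obtain p :: int
    where p: "prime p" "p dvd l" "\<not> p ^ 2 dvd l" "\<not> p dvd int n"
    by blast
  have "\<not> p dvd m"
    using p assms(3) by (metis gcd_greatest not_prime_unit)
  then have "\<not> p dvd int n * m ^ (n - 1)"
    using p by (auto simp: prime_dvd_mult_iff dest: prime_dvd_power)
  moreover have "p dvd Q n m (m - l) - int n * m ^ (n - 1)"
    \<comment> \<open>Here \<open>a - b\<close> is \<open>l\<close>, which is positive and divisible
      by \<open>p\<close>.\<close>
    using p assms by (intro Q_cong) auto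
  ultimately have Q: "\<not> p dvd Q n m (m - l)"
    using dvd_diff_right_iff by blast
  have const: "\<not> p ^ 2 dvd coeff (Y l m n) 0"
  proof
    assume "p ^ 2 dvd coeff (Y l m n) 0"
    then have "p ^ 2 dvd l * Q n m (m - l)"
      \<comment> \<open>Since \<open>n \<ge> 1\<close>, index 0 is not the leading one; the parity
        of \<open>n\<close> settles the sign.\<close>
      using assms(4) by (cases "even n") (auto simp: coeff_Y)
    moreover have "coprime (p ^ 2) (Q n m (m - l))"
      using p Q by (simp add: prime_imp_coprime)
    ultimately show False
      using p by (simp add: coprime_dvd_mult_left_iff)
  qed
  have lead: "\<not> p dvd lead_coeff (Y l m n)"
    using p(1) not_prime_unit by (auto simp: degree_Y coeff_Y)
  have low: "p dvd coeff (Y l m n) i" if "i < degree (Y l m n)" for i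
    using that p(2) by (simp add: degree_Y coeff_Y)
  show ?thesis
    unfolding irreducible_over_int_def reducible_over_int_def
    using eisenstein_criterion[OF prime_imp_prime_elem[OF p(1)] lead low const] by fastforce
qed

end
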